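(* Let $A=\begin{bmatrix}A_1&A_2&\cdots&A_k\end{bmatrix}\in\mathbb{R}^{m\times n}$, $m\ge n$, have full column rank, with $A_i\in\mathbb{R}^{m\times n_i}$ and $\sum_{i=1}^kn_i=n$. Consider the problem $$\min\ \{\omega((AB)^T(AB)) : B=\operatorname{Blkdiag}(B_1,\dots,B_k),\ B_i\in\mathbb{R}^{n_i\times n_i}\text{ nonsingular}\}.$$ (i) If the blocks $B_i$ are restricted to be diagonal, then an optimal solution is the diagonal preconditioner $B=\operatorname{Diag}(\operatorname{diag}(A^TA))^{-1/2}$. (ii) If the blocks $B_i$ are restricted to be upper triangular, then an optimal solution is given by $B_i=R_i^{-1}$, $i=1,\dots,k$, where $A_i=Q_iR_i$ is the (thin) QR decomposition of $A_i$, with $Q_i\in\mathbb{R}^{m\times n_i}$ having orthonormal columns and $R_i\in\mathbb{R}^{n_i\times n_i}$ upper triangular (unique up to the signs of the rows of $R_i$).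
   Context: For a symmetric positive definite $n\times n$ matrix $S$, $\omega(S)=\dfrac{\operatorname{trace}(S)/n}{\det(S)^{1/n}}$. $\operatorname{Blkdiag}(B_1,\dots,B_k)$ is the block diagonal matrix with diagonal blocks $B_1,\dots,B_k$; $\operatorname{diag}(S)$ is the vector of diagonal entries of $S$ and $\operatorname{Diag}(d)$ the diagonal matrix with diagonal $d$. *)

theory Defs
  imports
    "Jordan_Normal_Form.Gauss_Jordan_Elimination"
    "Jordan_Normal_Form.DL_Rank"
    Complex_Main
begin

definition mat_trace :: "'a::comm_monoid_add mat \<Rightarrow> 'a" where
  "mat_trace S = (\<Sum>i<dim_row S. S $$ (i, i))"

text \<open>The omega condition number. It is meant for symmetric positive definite \<open>S\<close> of order at
  least 1; then \<open>det S > 0\<close>, so that \<open>powr\<close> is the ordinary root.\<close>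

definition omega :: "real mat \<Rightarrow> real" where
  "omega S = (mat_trace S / real (dim_row S)) / (det S powr (1 / real (dim_row S)))"

text \<open>The matrix \<open>[A\<^sub>1 A\<^sub>2 \<dots> A\<^sub>k]\<close> with \<open>m\<close> rows.\<close>

definition block_row :: "nat \<Rightarrow> 'a mat list \<Rightarrow> 'a mat" where
  "block_row m As = mat_of_cols m (concat (map cols As))"

text \<open>\<open>P\<close> is the additional restriction on the shape of the individual blocks.\<close>

definition blkdiag_feasible :: "(real mat \<Rightarrow> bool) \<Rightarrow> nat list \<Rightarrow> real mat \<Rightarrow> bool" where
  "blkdiag_feasible P ns B \<longleftrightarrow>
     (\<exists>Bs. length Bs = length ns \<and>
           (\<forall>i<length ns. Bs ! i \<in> carrier_mat (ns ! i) (ns ! i) \<and> invertible_mat (Bs ! i) \<and> P (Bs ! i)) \<and>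
           B = diag_block_mat Bs)"

text \<open>\<open>Diag(d)\<close>; the library's \<open>diag_mat\<close> is the opposite operation \<open>diag(S)\<close>, returning
  the list of diagonal entries.\<close>

definition Diag :: "'a::zero list \<Rightarrow> 'a mat" where
  "Diag d = mat_diag (length d) (\<lambda>i. d ! i)"

text \<open>Real power of a diagonal matrix with positive diagonal; off-diagonal entries of \<open>D\<close>
  are ignored.\<close>

definition diag_powr :: "real mat \<Rightarrow> real \<Rightarrow> real mat" where
  "diag_powr D a = mat_diag (dim_row D) (\<lambda>i. (D $$ (i, i)) powr a)"

lemma diag_powr_Diag: "diag_powr (Diag d) a = mat_diag (length d) (\<lambda>i. (d ! i) powr a)"
  by (rule eq_matI) (auto simp: diag_powr_def Diag_def mat_diag_def)

lemma diag_powr_minus_half: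
  assumes "\<forall>i<length d. d ! i > 0"
  shows "diag_powr (Diag d) (- 1 / 2) * diag_powr (Diag d) (- 1 / 2) * Diag d = 1\<^sub>m (length d)"
proof -
  have "(d ! j) powr (- 1 / 2) * (d ! j) powr (- 1 / 2) * d ! j = 1" if "j < length d" for j
    using assms[rule_format, OF that] by (simp add: powr_add[symmetric] powr_minus field_simps)
  then show ?thesis
    unfolding diag_powr_Diag unfolding Diag_def mat_diag_diag
    by (intro eq_matI) (auto simp: mat_diag_def)
qed

definition thin_QR :: "real mat \<Rightarrow> real mat \<Rightarrow> real mat \<Rightarrow> bool" where
  "thin_QR A Q R \<longleftrightarrow>
     Q \<in> carrier_mat (dim_row A) (dim_col A) \<and> R \<in> carrier_mat (dim_col A) (dim_col A) \<and>
     transpose_mat Q * Q = 1\<^sub>m (dim_col A) \<and> upper_triangular R \<and> A = Q * R"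

end

theory Submission
  imports Defs "HOL-Analysis.Convex"
begin

text \<open>For block diagonal upper triangular \<open>B\<close> the trace of \<open>(AB)\<^sup>T(AB)\<close> is bounded below by a weighted sum
  \<open>\<Sum> c\<^sub>j b\<^sub>j\<^sub>j\<^sup>2\<close> of the squared diagonal entries, whereas its determinant is
  \<open>(\<Prod> b\<^sub>j\<^sub>j\<^sup>2) det(A\<^sup>TA)\<close>. By AM-GM, \<open>\<omega>\<close> is then at least \<open>(\<Prod> c\<^sub>j / det(A\<^sup>TA))\<^bsup>1/n\<^esup>\<close>, a bound free of \<open>B\<close>, and it
  is attained as soon as the trace is \<open>n\<close> and \<open>\<Prod> c\<^sub>j b\<^sub>j\<^sub>j\<^sup>2 = 1\<close>. For diagonal \<open>B\<close> the weights are the diagonal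
  entries of \<open>A\<^sup>TA\<close>. In the triangular case the trace is \<open>\<Sum> \<parallel>A\<^sub>iB\<^sub>i\<parallel>\<^sup>2 = \<Sum> \<parallel>R\<^sub>iB\<^sub>i\<parallel>\<^sup>2\<close> in the Frobenius norm,
  because the \<open>Q\<^sub>i\<close> are isometries, and the weights are the squared diagonal entries of the \<open>R\<^sub>i\<close>.\<close>

section \<open>The AM-GM lower bound for omega and its attainment\<close>

text \<open>Common core of both optimality claims: the shape of the blocks enters only through the
  weights \<open>c\<close> and the trace bound \<open>tr\<close>. The value at
  \<open>B\<^sub>0\<close> equals the AM-GM bound because its trace is \<open>n\<close> and its
  squared determinant is the reciprocal of the product of the weights.\<close>

lemma omega_gram_le:
  fixes A B B\<^sub>0 :: "real mat" and c :: "nat \<Rightarrow> real"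
  assumes A: "A \<in> carrier_mat m n" and n: "0 < n"
    and G: "det (transpose_mat A * A) > 0"
    and B: "B \<in> carrier_mat n n" "upper_triangular B" "det B \<noteq> 0"
    and c: "\<And>j. j < n \<Longrightarrow> c j > 0"
    and tr: "(\<Sum>j<n. c j * (B $$ (j, j))\<^sup>2) \<le> mat_trace (transpose_mat (A * B) * (A * B))"
    and B\<^sub>0: "B\<^sub>0 \<in> carrier_mat n n"
    and tr\<^sub>0: "mat_trace (transpose_mat (A * B\<^sub>0) * (A * B\<^sub>0)) = real n"
    and det\<^sub>0: "(det B\<^sub>0)\<^sup>2 * (\<Prod>j<n. c j) = 1"
  shows "omega (transpose_mat (A * B\<^sub>0) * (A * B\<^sub>0)) \<le> omega (transpose_mat (A * B) * (A * B))"
proof -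
  define D where "D = det (transpose_mat A * A)"
  define P where "P = (\<Prod>j<n. c j)"
  have D: "D > 0" using G by (simp add: D_def)
  have P: "P > 0" unfolding P_def by (rule prod_pos) (use c in auto)
  have det_gram: "det (transpose_mat (A * X) * (A * X)) = (det X)\<^sup>2 * D"
    if X: "X \<in> carrier_mat n n" for X
  proof -
    have GX: "transpose_mat A * A \<in> carrier_mat n n" using A by auto
    have "transpose_mat (A * X) * (A * X) = transpose_mat X * ((transpose_mat A * A) * X)"
      using A X by (simp add: transpose_mult[OF A X] assoc_mult_mat[of _ n m _ n _ n]
          assoc_mult_mat[of _ n n _ m _ n])
    also have "det \<dots> = det X * (D * det X)"
      using X GX by (simp add: det_mult[of _ n] det_transpose[of _ n] D_def)
    finally show ?thesis by (simp add: power2_eq_square)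
  qed
  have omega: "omega (transpose_mat (A * X) * (A * X)) =
      mat_trace (transpose_mat (A * X) * (A * X)) / n / ((det X)\<^sup>2 * D) powr (1 / n)"
    if X: "X \<in> carrier_mat n n" for X
    unfolding omega_def det_gram[OF X] using X by simp
  have b: "det B ^ 2 > 0" using B(3) by simp
  \<comment> \<open>\<open>B\<close> is triangular, so its squared determinant is the product of its
    squared diagonal entries. Distributing the weights over that product gives exactly the numbers
    to which AM-GM is applied.\<close>
  have "(det B)\<^sup>2 * P = (\<Prod>j<n. c j * (B $$ (j, j))\<^sup>2)"
    using B det_upper_triangular[OF B(2,1)]
    by (simp add: prod_list_diag_prod P_def prod.distrib power2_eq_square atLeast0LessThan mult_ac)
  also have "\<dots> powr (1 / n) \<le> (\<Sum>j<n. c j * (B $$ (j, j))\<^sup>2 / n)"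
    using arith_geom_mean[of "{..<n}" "\<lambda>j. c j * (B $$ (j, j))\<^sup>2"] n c
    by (simp add: less_imp_le lessThan_empty_iff)
  also have "\<dots> \<le> mat_trace (transpose_mat (A * B) * (A * B)) / n"
    using tr n by (simp add: sum_divide_distrib[symmetric] divide_right_mono)
  finally have amgm: "((det B)\<^sup>2 * P) powr (1 / n) \<le> mat_trace (transpose_mat (A * B) * (A * B)) / n" .
  have "(det B\<^sub>0)\<^sup>2 * P = 1" using det\<^sub>0 by (simp add: P_def)
  then have "(det B\<^sub>0)\<^sup>2 * D = D / P" using P by (simp add: eq_divide_eq mult_ac)
  then have "omega (transpose_mat (A * B\<^sub>0) * (A * B\<^sub>0)) = 1 / (D / P) powr (1 / n)"
    using omega[OF B\<^sub>0] tr\<^sub>0 n by simp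
  \<comment> \<open>Expanding the quotient by a power of \<open>(det B)\<^sup>2\<close> gives the
    constant bound the same denominator as omega at \<open>B\<close>. Only the numerators remain to
    be compared, and that is \<open>amgm\<close>.\<close>
  also have "\<dots> = ((det B)\<^sup>2 * P) powr (1 / n) / ((det B)\<^sup>2 * D) powr (1 / n)"
    using D P b by (simp add: powr_mult powr_divide)
  also have "\<dots> \<le> omega (transpose_mat (A * B) * (A * B))"
    unfolding omega[OF B(1)] by (rule divide_right_mono[OF amgm]) simp
  finally show ?thesis .
qed

section \<open>The squared Frobenius norm as the trace of a Gram matrix\<close>

definition frob_sq :: "real mat \<Rightarrow> real" where
  "frob_sq M = (\<Sum>i<dim_row M. \<Sum>j<dim_col M. (M $$ (i, j))\<^sup>2)"

lemma mat_trace_gram: "mat_trace (transpose_mat M * M) = frob_sq M"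
proof -
  have "mat_trace (transpose_mat M * M) = (\<Sum>j<dim_col M. \<Sum>i<dim_row M. (M $$ (i, j))\<^sup>2)"
    by (simp add: mat_trace_def scalar_prod_def atLeast0LessThan power2_eq_square)
  also have "\<dots> = frob_sq M" unfolding frob_sq_def by (rule sum.swap)
  finally show ?thesis .
qed

text \<open>The norm depends only on the Gram matrix, and orthonormality of the columns of
  \<open>Q\<close> makes \<open>Q\<close> cancel from the Gram matrix of
  \<open>Q * R\<close>.\<close>

lemma frob_sq_isometry:
  assumes Q: "Q \<in> carrier_mat m n" and iso: "transpose_mat Q * Q = 1\<^sub>m n"
    and R: "R \<in> carrier_mat n p"
  shows "frob_sq (Q * R) = frob_sq R"
proof -
  have "transpose_mat (Q * R) * (Q * R) = transpose_mat R * ((transpose_mat Q * Q) * R)"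
    using Q R by (simp add: transpose_mult[OF Q R] assoc_mult_mat[of _ n m _ n _ p]
        assoc_mult_mat[of _ p n _ m _ p])
  then have "transpose_mat (Q * R) * (Q * R) = transpose_mat R * R" using R iso by simp
  then show ?thesis by (metis mat_trace_gram)
qed

lemma frob_sq_eq_0_iff: "frob_sq M = 0 \<longleftrightarrow> M = 0\<^sub>m (dim_row M) (dim_col M)"
  by (auto simp: frob_sq_def sum_nonneg_eq_0_iff sum_nonneg mat_eq_iff)

lemma frob_sq_nonneg: "frob_sq M \<ge> 0"
  by (simp add: frob_sq_def sum_nonneg)

lemma sum_lessThan_split:
  "(\<Sum>i<a + b. f i) = (\<Sum>i<a. f i) + (\<Sum>i<b. f (a + i))" for f :: "nat \<Rightarrow> 'a::comm_monoid_add"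
  by (induction b) (simp_all add: add.assoc)

lemma frob_sq_four_block:
  assumes "A \<in> carrier_mat p r" "B \<in> carrier_mat p s" "C \<in> carrier_mat q r" "D \<in> carrier_mat q s"
  shows "frob_sq (four_block_mat A B C D) = frob_sq A + frob_sq B + frob_sq C + frob_sq D"
  using assms by (simp add: frob_sq_def sum_lessThan_split sum.distrib)

lemma frob_sq_zero [simp]: "frob_sq (0\<^sub>m p q) = 0"
  by (simp add: frob_sq_def)

lemma frob_sq_one [simp]: "frob_sq (1\<^sub>m n) = real n"
proof -
  have "frob_sq (1\<^sub>m n) = (\<Sum>i<n. \<Sum>j<n. if i = j then 1 else 0)"
    unfolding frob_sq_def by (intro sum.cong) auto
  then show ?thesis by simp
qed

section \<open>Full column rank as a trivial kernel\<close>

text \<open>Injectivity is phrased with \<open>n \<times> 1\<close> matrices instead of vectors so that block multiplication applies.\<close>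

definition inj_cols :: "'a::semiring_0 mat \<Rightarrow> bool" where
  "inj_cols A \<longleftrightarrow> (\<forall>X \<in> carrier_mat (dim_col A) 1. A * X = 0\<^sub>m (dim_row A) 1 \<longrightarrow> X = 0\<^sub>m (dim_col A) 1)"

text \<open>Horizontal concatenation is encoded as a four-block matrix whose lower blocks have no
  rows, so that the block rules for products and transposes apply to it.\<close>

abbreviation hcat :: "'a::zero mat \<Rightarrow> 'a mat \<Rightarrow> 'a mat" where
  "hcat A B \<equiv> four_block_mat A B (0\<^sub>m 0 (dim_col A)) (0\<^sub>m 0 (dim_col B))"

lemma inj_colsD:
  "inj_cols A \<Longrightarrow> A \<in> carrier_mat m n \<Longrightarrow> X \<in> carrier_mat n 1 \<Longrightarrow> A * X = 0\<^sub>m m 1 \<Longrightarrow> X = 0\<^sub>m n 1"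
  by (auto simp: inj_cols_def)

lemma inj_colsI:
  assumes "A \<in> carrier_mat m n"
    and "\<And>x. x \<in> carrier_vec n \<Longrightarrow> A *\<^sub>v x = 0\<^sub>v m \<Longrightarrow> x = 0\<^sub>v n"
  shows "inj_cols A"
  unfolding inj_cols_def
proof (intro ballI impI)
  fix X assume X: "X \<in> carrier_mat (dim_col A) 1" and AX: "A * X = 0\<^sub>m (dim_row A) 1"
  have "A *\<^sub>v col X 0 = col (A * X) 0" using X assms(1) by (auto intro!: eq_vecI)
  also have "\<dots> = 0\<^sub>v m" using AX assms(1) by auto
  finally have "col X 0 = 0\<^sub>v n" using assms X by (intro assms(2) carrier_vecI) auto
  then have "X $$ (i, 0) = 0" if "i < n" for i
    using that X assms(1) by (metis carrier_matD col_def index_vec index_zero_vec(1))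
  then show "X = 0\<^sub>m (dim_col A) 1" using X assms(1) by (auto intro!: eq_matI)
qed

lemma inj_cols_mat_mult_vec:
  assumes "inj_cols A" "A \<in> carrier_mat m n" "x \<in> carrier_vec n" "A *\<^sub>v x = 0\<^sub>v m"
  shows "x = 0\<^sub>v n"
proof -
  define X where "X = mat_of_cols n [x]"
  have X: "X \<in> carrier_mat n 1" by (intro carrier_matI) (simp_all add: X_def)
  have col: "col X 0 = x" using assms(3) by (simp add: X_def)
  have "A * X = 0\<^sub>m m 1"
  proof (rule eq_matI)
    fix i j assume ij: "i < dim_row (0\<^sub>m m 1 :: 'a mat)" "j < dim_col (0\<^sub>m m 1 :: 'a mat)"
    then have "(A * X) $$ (i, j) = (A *\<^sub>v x) $ i"
      using assms(2) X col by (simp add: index_mult_mat)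
    then show "(A * X) $$ (i, j) = 0\<^sub>m m 1 $$ (i, j)" using ij assms(4) by simp
  qed (use assms X in auto)
  from inj_colsD[OF assms(1,2) X this] have "col X 0 = 0\<^sub>v n" by simp
  with col show ?thesis by simp
qed

text \<open>Linear independence here concerns the set of columns, so repeated columns have to be
  excluded first: with a repetition, a maximal independent set of columns has fewer than
  \<open>nc\<close> elements, contradicting the rank. Once the columns are distinct and independent,
  a nonzero kernel vector would be a linear dependence.\<close>

lemma (in vec_space) full_rank_inj_cols:
  assumes A: "A \<in> carrier_mat n nc" and r: "rank A = nc"
  shows "inj_cols A"
proof -
  have "distinct (cols A)"
  proof (rule ccontr)
    assume "\<not> distinct (cols A)"
    then have lt: "card (set (cols A)) < nc"
      using A by (metis card_distinct card_length carrier_matD(2) cols_length nat_less_le)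
    obtain S where S: "maximal S (\<lambda>T. T \<subseteq> set (cols A) \<and> lin_indpt T)"
      using maximal_exists[of "\<lambda>T. T \<subseteq> set (cols A) \<and> lin_indpt T" "card (set (cols A))" "{}"]
      by (meson List.finite_set card_mono empty_iff empty_subsetI finite_lin_indpt2 rev_finite_subset)
    then have "card S \<le> card (set (cols A))" by (simp add: card_mono maximal_def)
    then show False using rank_card_indpt[OF A S] r lt by simp
  qed
  then show ?thesis
    using lin_depI[OF A] full_rank_lin_indpt[OF A r] by (intro inj_colsI[OF A]) blast
qed

lemma inj_cols_imp_det_nonzero:
  fixes R :: "'a::field mat"
  assumes "inj_cols R" "R \<in> carrier_mat n n"
  shows "det R \<noteq> 0"
  using inj_cols_mat_mult_vec[OF assms] det_0_iff_vec_prod_zero_field[OF assms(2)] by blast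

lemma inj_cols_multD:
  assumes "inj_cols (Q * R)" and Q: "Q \<in> carrier_mat m n" and R: "R \<in> carrier_mat n p"
  shows "inj_cols R"
  unfolding inj_cols_def
proof (intro ballI impI)
  fix X assume X: "X \<in> carrier_mat (dim_col R) 1" and RX: "R * X = 0\<^sub>m (dim_row R) 1"
  have "(Q * R) * X = 0\<^sub>m m 1" using X RX Q R by (simp add: assoc_mult_mat[OF Q R, of X 1])
  then show "X = 0\<^sub>m (dim_col R) 1"
    using inj_colsD[OF assms(1) mult_carrier_mat[OF Q R]] X R by simp
qed

text \<open>A relation between the columns of \<open>A\<close> and those of \<open>B\<close> is a
  kernel vector of the concatenation. Besides passing injectivity to the blocks, this shows in
  Gram-Schmidt that the residual does not vanish.\<close>

lemma inj_cols_hcat: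
  assumes inj: "inj_cols (hcat A B)" and A: "A \<in> carrier_mat m p" and B: "B \<in> carrier_mat m q"
    and X: "X \<in> carrier_mat p 1" and Y: "Y \<in> carrier_mat q 1" and zero: "A * X + B * Y = 0\<^sub>m m 1"
  shows "X = 0\<^sub>m p 1 \<and> Y = 0\<^sub>m q 1"
proof -
  \<comment> \<open>\<open>X\<close> is stacked on \<open>Y\<close>; the right-hand blocks of width
    0 only serve to give the column four-block form.\<close>
  let ?Z = "four_block_mat X (0\<^sub>m p 0) Y (0\<^sub>m q 0)"
  have AB: "hcat A B \<in> carrier_mat m (p + q)" using A B by auto
  have "hcat A B * ?Z =
      four_block_mat (A * X + B * Y) (A * 0\<^sub>m p 0 + B * 0\<^sub>m q 0)
        (0\<^sub>m 0 p * X + 0\<^sub>m 0 q * Y) (0\<^sub>m 0 p * 0\<^sub>m p 0 + 0\<^sub>m 0 q * 0\<^sub>m q 0)"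
    using mult_four_block_mat[of A m p B q "0\<^sub>m 0 p" 0 "0\<^sub>m 0 q" X 1 "0\<^sub>m p 0" 0 Y "0\<^sub>m q 0"] A B X Y
    by simp
  also have "\<dots> = A * X + B * Y" using A B X Y by auto
  finally have "hcat A B * ?Z = 0\<^sub>m m 1" using zero by simp
  moreover have "?Z \<in> carrier_mat (p + q) 1" using X Y by auto
  ultimately have Z: "?Z = 0\<^sub>m (p + q) 1" using inj_colsD[OF inj AB] by simp
  have "X $$ (i, 0) = 0" if "i < p" for i
    using arg_cong[OF Z, of "\<lambda>M. M $$ (i, 0)"] that X Y by simp
  moreover have "Y $$ (i, 0) = 0" if "i < q" for i
    using arg_cong[OF Z, of "\<lambda>M. M $$ (p + i, 0)"] that X Y by simp
  ultimately show ?thesis using X Y by auto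
qed

lemma inj_cols_hcatD:
  assumes "inj_cols (hcat A B)" and A: "A \<in> carrier_mat m p" and B: "B \<in> carrier_mat m q"
  shows "inj_cols A" "inj_cols B"
  using inj_cols_hcat[OF assms, of _ "0\<^sub>m q 1"] inj_cols_hcat[OF assms, of "0\<^sub>m p 1"] A B
  by (auto simp: inj_cols_def)

text \<open>A block diagonal right factor acts on each block column separately; this is the source
  of the splitting of the trace over the blocks.\<close>

lemma mult_hcat_block_diag:
  fixes A B X Y :: "'a::comm_ring_1 mat"
  assumes "A \<in> carrier_mat m p" "B \<in> carrier_mat m q" "X \<in> carrier_mat p r" "Y \<in> carrier_mat q s"
  shows "hcat A B * four_block_mat X (0\<^sub>m p s) (0\<^sub>m q r) Y = hcat (A * X) (B * Y)"
proof -
  have "hcat A B * four_block_mat X (0\<^sub>m p s) (0\<^sub>m q r) Y =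
      four_block_mat (A * X + B * 0\<^sub>m q r) (A * 0\<^sub>m p s + B * Y)
        (0\<^sub>m 0 p * X + 0\<^sub>m 0 q * 0\<^sub>m q r) (0\<^sub>m 0 p * 0\<^sub>m p s + 0\<^sub>m 0 q * Y)"
    using mult_four_block_mat[of A m p B q "0\<^sub>m 0 p" 0 "0\<^sub>m 0 q" X r "0\<^sub>m p s" s "0\<^sub>m q r" Y] assms
    by simp
  also have "\<dots> = hcat (A * X) (B * Y)" using assms by (intro cong_four_block_mat) auto
  finally show ?thesis .
qed

section \<open>Existence and uniqueness of the thin QR decomposition\<close>

lemma frob_sq_smult: "frob_sq (c \<cdot>\<^sub>m M) = c\<^sup>2 * frob_sq M"
  by (simp add: frob_sq_def power_mult_distrib sum_distrib_left)

lemma gram_one_col: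
  assumes "v \<in> carrier_mat m 1"
  shows "transpose_mat v * v = frob_sq v \<cdot>\<^sub>m 1\<^sub>m 1"
  using assms
  by (intro eq_matI) (auto simp: scalar_prod_def frob_sq_def atLeast0LessThan power2_eq_square)

text \<open>Gram-Schmidt as an induction on the number of columns, splitting off the last one. The
  first \<open>n\<close> columns inherit injectivity and hence a decomposition, which is then
  extended by one column of \<open>Q\<close> and bordered by one row and column of
  \<open>R\<close>.\<close>

lemma thin_QR_exists:
  assumes "A \<in> carrier_mat m n" "inj_cols A"
  shows "\<exists>Q R. thin_QR A Q R"
  using assms
proof (induction n arbitrary: A)
  case 0
  then have "thin_QR A A (0\<^sub>m 0 0)" by (auto simp: thin_QR_def intro!: eq_matI)
  then show ?case by blast
next
  case (Suc n)
  define A' where "A' = mat m n (\<lambda>(i, j). A $$ (i, j))"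
  define a where "a = mat m 1 (\<lambda>(i, j). A $$ (i, n))"
  have A': "A' \<in> carrier_mat m n" and a: "a \<in> carrier_mat m 1" by (auto simp: A'_def a_def)
  have A_eq: "A = hcat A' a"
    using Suc.prems(1) by (auto intro!: eq_matI simp: A'_def a_def less_Suc_eq)
  note inj = inj_cols_hcatD[OF Suc.prems(2)[unfolded A_eq] A' a]
  obtain Q R where "thin_QR A' Q R" using Suc.IH[OF A' inj(1)] by blast
  then have Q: "Q \<in> carrier_mat m n" and R: "R \<in> carrier_mat n n" and iso: "transpose_mat Q * Q = 1\<^sub>m n"
    and ut: "upper_triangular R" and A'_eq: "A' = Q * R"
    using A' by (auto simp: thin_QR_def)
  \<comment> \<open>one Gram-Schmidt step on the last column\<close>
  define w where "w = transpose_mat Q * a"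
  define v where "v = a - Q * w"
  have w: "w \<in> carrier_mat n 1" and v: "v \<in> carrier_mat m 1" using Q a by (auto simp: w_def v_def)
  have Qw: "Q * w \<in> carrier_mat m 1" using Q w by auto
  have a_eq: "Q * w + v = a" using a Qw by (auto intro!: eq_matI simp: v_def carrier_matD simp del: index_mult_mat)
  have Qt: "transpose_mat Q \<in> carrier_mat n m" using Q by simp
  have "transpose_mat Q * v = transpose_mat Q * a - transpose_mat Q * (Q * w)"
    unfolding v_def by (rule mult_minus_distrib_mat[OF Qt a Qw])
  also have "transpose_mat Q * (Q * w) = w" using iso w by (simp flip: assoc_mult_mat[OF Qt Q w])
  finally have Qv: "transpose_mat Q * v = 0\<^sub>m n 1" using w by (simp add: w_def)
  have vQ: "transpose_mat v * Q = 0\<^sub>m 1 n"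
    using arg_cong[OF Qv, of transpose_mat] by (simp add: transpose_mult[OF Qt v])
  \<comment> \<open>If the residual vanished, \<open>a\<close> would lie in the range of
    \<open>Q\<close>. As \<open>R\<close> is invertible, \<open>a\<close> would then be a
    combination of the columns of \<open>A'\<close>, a relation in which \<open>a\<close> has
    coefficient -1, against injectivity of \<open>A\<close>.\<close>
  have "v \<noteq> 0\<^sub>m m 1"
  proof
    assume v0: "v = 0\<^sub>m m 1"
    have "det R \<noteq> 0"
      using inj_cols_multD[OF inj(1)[unfolded A'_eq] Q R] R by (rule inj_cols_imp_det_nonzero)
    then obtain S where S: "S \<in> carrier_mat n n" "R * S = 1\<^sub>m n"
      using det_non_zero_imp_unit[OF R, of "()"] by (auto simp: Units_def ring_mat_def)
    let ?y = "S * w"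
    have y: "?y \<in> carrier_mat n 1" using S w by auto
    have Ry: "R * ?y = w" using S w by (simp flip: assoc_mult_mat[OF R S(1) w])
    have "A' * ?y = a"
      using a_eq Qw v0 Ry unfolding A'_eq by (simp add: assoc_mult_mat[OF Q R y])
    then have "A' * ?y + a * (- 1\<^sub>m 1) = 0\<^sub>m m 1"
      using a comm_add_mat[OF a, of "- a"] by simp
    then have "- 1\<^sub>m 1 = (0\<^sub>m 1 1 :: real mat)"
      using inj_cols_hcat[OF Suc.prems(2)[unfolded A_eq] A' a y, of "- 1\<^sub>m 1"] by simp
    from arg_cong[OF this, of "\<lambda>M. M $$ (0, 0)"] show False by simp
  qed
  then have pos: "frob_sq v > 0"
    using frob_sq_eq_0_iff[of v] frob_sq_nonneg[of v] v by auto
  define \<rho> where "\<rho> = sqrt (frob_sq v)"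
  have \<rho>: "\<rho> > 0" "\<rho> * \<rho> = frob_sq v" using pos by (auto simp: \<rho>_def)
  define q where "q = (1 / \<rho>) \<cdot>\<^sub>m v"
  have q: "q \<in> carrier_mat m 1" using v by (simp add: q_def)
  have Qq: "transpose_mat Q * q = 0\<^sub>m n 1" using Qv by (simp add: q_def mult_smult_distrib[OF Qt v])
  have qQ: "transpose_mat q * Q = 0\<^sub>m 1 n"
    using arg_cong[OF Qq, of transpose_mat] by (simp add: transpose_mult[OF Qt q])
  have qq: "transpose_mat q * q = 1\<^sub>m 1"
    using \<rho> unfolding gram_one_col[OF q]
    by (auto intro!: eq_matI simp: q_def frob_sq_smult power2_eq_square field_simps)
  \<comment> \<open>The new last column of \<open>R'\<close> holds the coordinates of
    \<open>a\<close> with respect to \<open>Q\<close> and \<open>q\<close>: \<open>w\<close> from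
    the projection and the length \<rho> of the residual in the corner.\<close>
  define Q' where "Q' = hcat Q q"
  define R' where "R' = four_block_mat R w (0\<^sub>m 1 n) (\<rho> \<cdot>\<^sub>m 1\<^sub>m 1)"
  have Q': "Q' \<in> carrier_mat m (Suc n)" and R': "R' \<in> carrier_mat (Suc n) (Suc n)"
    using Q q R by (auto simp: Q'_def R'_def)
  have "transpose_mat Q' = four_block_mat (transpose_mat Q) (0\<^sub>m n 0) (transpose_mat q) (0\<^sub>m 1 0)"
    using Q q unfolding Q'_def by (subst transpose_four_block_mat[of _ m n _ 1 _ 0]) auto
  then have "transpose_mat Q' * Q' = four_block_mat (transpose_mat Q * Q + 0\<^sub>m n 0 * 0\<^sub>m 0 n)
      (transpose_mat Q * q + 0\<^sub>m n 0 * 0\<^sub>m 0 1) (transpose_mat q * Q + 0\<^sub>m 1 0 * 0\<^sub>m 0 n)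
      (transpose_mat q * q + 0\<^sub>m 1 0 * 0\<^sub>m 0 1)"
    using Q q unfolding Q'_def by (simp add: mult_four_block_mat[of _ n m _ 0 _ 1 _ _ n _ 1])
  also have "\<dots> = four_block_mat (1\<^sub>m n) (0\<^sub>m n 1) (0\<^sub>m 1 n) (1\<^sub>m 1)"
    by (simp add: iso Qq qQ qq)
  finally have iso': "transpose_mat Q' * Q' = 1\<^sub>m (Suc n)" by simp
  have "Q' * R' = four_block_mat (Q * R + q * 0\<^sub>m 1 n) (Q * w + q * (\<rho> \<cdot>\<^sub>m 1\<^sub>m 1))
      (0\<^sub>m 0 n * R + 0\<^sub>m 0 1 * 0\<^sub>m 1 n) (0\<^sub>m 0 n * w + 0\<^sub>m 0 1 * (\<rho> \<cdot>\<^sub>m 1\<^sub>m 1))"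
    using Q q R w unfolding Q'_def R'_def by (simp add: mult_four_block_mat[of _ m n _ 1 _ 0 _ _ n _ 1])
  also have "q * (\<rho> \<cdot>\<^sub>m 1\<^sub>m 1) = v"
    using \<rho> q v by (auto simp: mult_smult_distrib[OF q] q_def intro!: eq_matI)
  finally have "Q' * R' = A"
    using Q R q w a A' a_eq A'_eq A_eq by (auto intro!: cong_four_block_mat)
  moreover have "upper_triangular R'"
    unfolding R'_def by (intro upper_triangular_four_block[OF R _ ut]) auto
  ultimately have "thin_QR A Q' R'"
    using Q' R' iso' Suc.prems(1) by (auto simp: thin_QR_def)
  then show ?case by blast
qed

text \<open>Along a fixed row \<open>i\<close>, induction on the column index \<open>j\<close> below
  the diagonal: in the entry of \<open>X * R\<close> the terms with \<open>k < j\<close> vanish by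
  induction and those with \<open>k > j\<close> by the shape of \<open>R\<close>. What remains is
  one term with a nonzero factor \<open>R $$ (j, j)\<close>. Applied with the identity as the
  product, it shows that inverses of upper triangular matrices are upper triangular.\<close>

lemma upper_triangular_left_factor:
  fixes X R :: "'a::idom mat"
  assumes X: "X \<in> carrier_mat n n" and R: "R \<in> carrier_mat n n" "upper_triangular R" "det R \<noteq> 0"
    and XR: "upper_triangular (X * R)"
  shows "upper_triangular X"
proof
  fix i j assume "j < i" and i: "i < dim_row X"
  have diag: "R $$ (j, j) \<noteq> 0" if "j < n" for j
    using R(3) that unfolding det_upper_triangular[OF R(2,1)] prod_list_diag_prod
    using R(1) by auto
  from \<open>j < i\<close> show "X $$ (i, j) = 0"
  proof (induction j rule: less_induct)
    case (less j)
    have j: "j < n" using less.prems i X by simp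
    have "0 = (X * R) $$ (i, j)" using XR X i less.prems by (auto simp: upper_triangular_def)
    also have "\<dots> = (\<Sum>k<n. X $$ (i, k) * R $$ (k, j))"
      using X R i j by (simp add: scalar_prod_def atLeast0LessThan)
    also have "\<dots> = (\<Sum>k\<in>{j}. X $$ (i, k) * R $$ (k, j))"
    proof (rule sum.mono_neutral_right)
      show "\<forall>k \<in> {..<n} - {j}. X $$ (i, k) * R $$ (k, j) = 0"
      proof
        fix k assume k: "k \<in> {..<n} - {j}"
        then consider "k < j" | "j < k" by force
        then show "X $$ (i, k) * R $$ (k, j) = 0"
          using less k R(1,2) by cases (auto simp: upper_triangular_def)
      qed
    qed (use j in auto)
    finally show ?case using diag[OF j] by simp
  qed
qed

lemma mult_mat_right_cancel:
  fixes X Y R :: "'a::field mat"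
  assumes X: "X \<in> carrier_mat m n" and Y: "Y \<in> carrier_mat m n"
    and R: "R \<in> carrier_mat n n" "det R \<noteq> 0" and eq: "X * R = Y * R"
  shows "X = Y"
proof -
  obtain S where S: "S \<in> carrier_mat n n" "R * S = 1\<^sub>m n"
    using det_non_zero_imp_unit[OF R, of "()"] by (auto simp: Units_def ring_mat_def)
  have "X * (R * S) = Y * (R * S)"
    using eq assoc_mult_mat[OF X R(1) S(1)] assoc_mult_mat[OF Y R(1) S(1)] by simp
  then show ?thesis using X Y S(2) by simp
qed

text \<open>The transition matrix \<open>T\<close>, the product of the transpose of
  \<open>Q'\<close> with \<open>Q\<close>, carries \<open>R\<close> to \<open>R'\<close>, and its
  transpose carries \<open>R'\<close> back to \<open>R\<close>. Both are therefore left factors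
  between nonsingular upper triangular matrices, which forces \<open>T\<close> to be diagonal and
  its own inverse.\<close>

lemma thin_QR_unique:
  assumes A: "A \<in> carrier_mat m n" "inj_cols A"
    and QR: "thin_QR A Q R" and QR': "thin_QR A Q' R'"
  shows "\<exists>s. (\<forall>j<n. s j \<in> {1, - 1}) \<and> R' = mat_diag n s * R \<and> Q' = Q * mat_diag n s"
proof -
  have Q: "Q \<in> carrier_mat m n" and R: "R \<in> carrier_mat n n" and iso: "transpose_mat Q * Q = 1\<^sub>m n"
    and ut: "upper_triangular R" and A_eq: "A = Q * R"
    using QR A by (auto simp: thin_QR_def)
  have Q': "Q' \<in> carrier_mat m n" and R': "R' \<in> carrier_mat n n" and iso': "transpose_mat Q' * Q' = 1\<^sub>m n"
    and ut': "upper_triangular R'" and A_eq': "A = Q' * R'"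
    using QR' A by (auto simp: thin_QR_def)
  have "inj_cols R" using inj_cols_multD[OF _ Q R] A(2) A_eq by simp
  then have detR: "det R \<noteq> 0" using R by (rule inj_cols_imp_det_nonzero)
  have "inj_cols R'" using inj_cols_multD[OF _ Q' R'] A(2) A_eq' by simp
  then have detR': "det R' \<noteq> 0" using R' by (rule inj_cols_imp_det_nonzero)
  have Qt: "transpose_mat Q \<in> carrier_mat n m" and Qt': "transpose_mat Q' \<in> carrier_mat n m"
    using Q Q' by auto
  define T where "T = transpose_mat Q' * Q"
  have T: "T \<in> carrier_mat n n" and Tt: "transpose_mat T \<in> carrier_mat n n" using Q Q' by (auto simp: T_def)
  have "T * R = transpose_mat Q' * A"
    unfolding T_def A_eq by (rule assoc_mult_mat[OF Qt' Q R])
  also have "\<dots> = R'"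
    using assoc_mult_mat[OF Qt' Q' R'] iso' R' by (simp add: A_eq')
  finally have TR: "T * R = R'" .
  have "transpose_mat T = transpose_mat Q * Q'" by (simp add: T_def transpose_mult[OF Qt' Q])
  then have "transpose_mat T * R' = transpose_mat Q * A"
    unfolding A_eq' using assoc_mult_mat[OF Qt Q' R'] by simp
  also have "\<dots> = R"
    using assoc_mult_mat[OF Qt Q R] iso R by (simp add: A_eq)
  finally have TR': "transpose_mat T * R' = R" .
  \<comment> \<open>\<open>T\<close> is upper triangular and orthogonal, hence diagonal with entries \<open>\<plusminus>1\<close>\<close>
  have "upper_triangular T" "upper_triangular (transpose_mat T)"
    using upper_triangular_left_factor[OF T R ut detR] upper_triangular_left_factor[OF Tt R' ut' detR']
      TR TR' ut ut' by auto
  then have off: "T $$ (i, j) = 0" if "i < n" "j < n" "i \<noteq> j" for i j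
    using that T by (cases "i < j") (auto simp: upper_triangular_def)
  define s where "s j = T $$ (j, j)" for j
  have T_eq: "T = mat_diag n s" using T off by (auto intro!: eq_matI simp: s_def mat_diag_def)
  have Tt_eq: "transpose_mat T = T" using T off by (auto intro!: eq_matI) (metis)
  have TTR: "T * R' = R" using TR' Tt_eq by simp
  have "(T * T) * R = 1\<^sub>m n * R" using assoc_mult_mat[OF T T R] TR TTR R by simp
  note TT = mult_mat_right_cancel[OF mult_carrier_mat[OF T T] one_carrier_mat R detR this]
  have ss: "mat_diag n (\<lambda>j. s j * s j) = 1\<^sub>m n" using TT by (simp add: T_eq)
  have "s j * s j = 1" if "j < n" for j
    using arg_cong[OF ss, of "\<lambda>M. M $$ (j, j)"] that by (simp add: mat_diag_def)
  then have "\<forall>j<n. s j \<in> {1, - 1}" using square_eq_1_iff by auto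
  \<comment> \<open>Both sides equal \<open>A\<close>, since \<open>T * R'\<close> is
    \<open>R\<close>; cancelling the nonsingular \<open>R'\<close> expresses \<open>Q'\<close>
    through \<open>Q\<close>.\<close>
  moreover have "Q' * R' = (Q * T) * R'"
    using assoc_mult_mat[OF Q T R'] TTR A_eq A_eq' by simp
  note mult_mat_right_cancel[OF Q' mult_carrier_mat[OF Q T] R' detR' this]
  ultimately show ?thesis using TR T_eq by auto
qed

section \<open>Block rows and block diagonal matrices\<close>

lemma block_row_Cons:
  assumes "A \<in> carrier_mat m p"
  shows "block_row m (A # As) = hcat A (block_row m As)"
  using assms
  by (intro eq_matI) (auto simp: block_row_def mat_of_cols_index nth_append)

lemma block_row_carrier:
  fixes As :: "'a::zero mat list"
  shows "list_all2 (\<lambda>A p. A \<in> carrier_mat m p) As ns \<Longrightarrow> block_row m As \<in> carrier_mat m (sum_list ns)"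
proof (induction rule: list_all2_induct)
  case Nil
  show ?case by (intro carrier_matI) (simp_all add: block_row_def)
next
  case (Cons A As p ns)
  then show ?case using block_row_Cons[OF Cons.hyps(1), of As] by (auto intro!: carrier_matI)
qed

lemma inj_cols_block_row:
  "list_all2 (\<lambda>A p. A \<in> carrier_mat m p) As ns \<Longrightarrow> inj_cols (block_row m As) \<Longrightarrow> A \<in> set As \<Longrightarrow> inj_cols A"
proof (induction rule: list_all2_induct)
  case (Cons A' As p ns)
  then have A': "A' \<in> carrier_mat m p" by simp
  note D = inj_cols_hcatD[OF Cons.prems(1)[unfolded block_row_Cons[OF A']] A' block_row_carrier[OF Cons.hyps(2)]]
  show ?case using D Cons.IH Cons.prems(2) by auto
qed simp

lemma diag_block_mat_carrier:
  "list_all2 (\<lambda>B p. B \<in> carrier_mat p p) Bs ns \<Longrightarrow> diag_block_mat Bs \<in> carrier_mat (sum_list ns) (sum_list ns)"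
  by (induction rule: list_all2_induct) (auto simp: Let_def)

lemma diag_block_mat_Cons:
  assumes "B \<in> carrier_mat p p" "list_all2 (\<lambda>B p. B \<in> carrier_mat p p) Bs ns"
  shows "diag_block_mat (B # Bs) =
    four_block_mat B (0\<^sub>m p (sum_list ns)) (0\<^sub>m (sum_list ns) p) (diag_block_mat Bs)"
  using assms(1) diag_block_mat_carrier[OF assms(2)] by (simp add: Let_def)

text \<open>The products of corresponding blocks stand side by side, so their squared norms add
  up.\<close>

lemma frob_sq_block_row_mult:
  assumes "list_all2 (\<lambda>A p. A \<in> carrier_mat m p) As ns" "list_all2 (\<lambda>B p. B \<in> carrier_mat p p) Bs ns"
  shows "frob_sq (block_row m As * diag_block_mat Bs) = sum_list (map2 (\<lambda>A B. frob_sq (A * B)) As Bs)"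
  using assms
proof (induction ns arbitrary: As Bs rule: list.induct)
  case Nil
  then show ?case by (simp add: frob_sq_def)
next
  case (Cons p ns)
  then obtain A As' B Bs' where eq: "As = A # As'" "Bs = B # Bs'"
    and A: "A \<in> carrier_mat m p" and B: "B \<in> carrier_mat p p"
    and As': "list_all2 (\<lambda>A p. A \<in> carrier_mat m p) As' ns"
    and Bs': "list_all2 (\<lambda>B p. B \<in> carrier_mat p p) Bs' ns"
    by (auto simp: list_all2_Cons2)
  note c = block_row_carrier[OF As'] diag_block_mat_carrier[OF Bs']
  have "frob_sq (block_row m As * diag_block_mat Bs) =
      frob_sq (hcat (A * B) (block_row m As' * diag_block_mat Bs'))"
    unfolding eq block_row_Cons[OF A] diag_block_mat_Cons[OF B Bs']
    by (simp only: mult_hcat_block_diag[OF A c(1) B c(2)])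
  also have "\<dots> = frob_sq (A * B) + frob_sq (block_row m As' * diag_block_mat Bs')"
    using A B c by (simp add: frob_sq_four_block[of _ m p _ "sum_list ns" _ 0])
  finally show ?case using Cons.IH[OF As' Bs'] eq by simp
qed

lemma mult_block_diag:
  fixes A B X Y :: "'a::comm_ring_1 mat"
  assumes "A \<in> carrier_mat p p" "B \<in> carrier_mat q q" "X \<in> carrier_mat p p" "Y \<in> carrier_mat q q"
  shows "four_block_mat A (0\<^sub>m p q) (0\<^sub>m q p) B * four_block_mat X (0\<^sub>m p q) (0\<^sub>m q p) Y =
    four_block_mat (A * X) (0\<^sub>m p q) (0\<^sub>m q p) (B * Y)"
  using assms by (simp add: mult_four_block_mat[of _ p p _ q _ q _ _ p _ q])

text \<open>The shape of the products is proved along with the identity, because the induction step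
  needs it to unfold the block diagonal matrix of the product list.\<close>

lemma diag_block_mat_mult:
  fixes As Bs :: "'a::comm_ring_1 mat list"
  assumes "list_all2 (\<lambda>B p. B \<in> carrier_mat p p) As ns" "list_all2 (\<lambda>B p. B \<in> carrier_mat p p) Bs ns"
  shows "diag_block_mat As * diag_block_mat Bs = diag_block_mat (map2 (*) As Bs) \<and>
    list_all2 (\<lambda>B p. B \<in> carrier_mat p p) (map2 (*) As Bs) ns"
  using assms
proof (induction ns arbitrary: As Bs rule: list.induct)
  case (Cons p ns)
  then obtain A As' B Bs' where eq: "As = A # As'" "Bs = B # Bs'"
    and A: "A \<in> carrier_mat p p" and B: "B \<in> carrier_mat p p"
    and As': "list_all2 (\<lambda>B p. B \<in> carrier_mat p p) As' ns"
    and Bs': "list_all2 (\<lambda>B p. B \<in> carrier_mat p p) Bs' ns"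
    by (auto simp: list_all2_Cons2)
  note c = diag_block_mat_carrier[OF As'] diag_block_mat_carrier[OF Bs']
  have AB: "A * B \<in> carrier_mat p p" using A B by simp
  show ?case
    using Cons.IH[OF As' Bs'] AB unfolding eq
    by (simp add: diag_block_mat_Cons[OF A As'] diag_block_mat_Cons[OF B Bs']
        diag_block_mat_Cons[OF AB conjunct2[OF Cons.IH[OF As' Bs']]] mult_block_diag[OF A c(1) B c(2)] del: diag_block_mat.simps(2))
qed simp

lemma frob_sq_diag_block_mat:
  assumes "list_all2 (\<lambda>B p. B \<in> carrier_mat p p) Bs ns"
  shows "frob_sq (diag_block_mat Bs) = sum_list (map frob_sq Bs)"
  using assms
proof (induction rule: list_all2_induct)
  case Nil
  show ?case by (simp add: frob_sq_def)
next
  case (Cons B Bs p ns)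
  then show ?case
    using diag_block_mat_carrier[OF Cons.hyps(2)]
    by (simp add: diag_block_mat_Cons[OF _ Cons.hyps(2)] frob_sq_four_block[of _ p p _ "sum_list ns" _ "sum_list ns"]
        del: diag_block_mat.simps(2))
qed

lemma det_diag_block_mat:
  fixes Bs :: "'a::idom mat list"
  assumes "list_all2 (\<lambda>B p. B \<in> carrier_mat p p) Bs ns"
  shows "det (diag_block_mat Bs) = prod_list (map det Bs)"
  using assms
proof (induction rule: list_all2_induct)
  case (Cons B Bs p ns)
  then show ?case
    using diag_block_mat_carrier[OF Cons.hyps(2)]
    by (simp add: diag_block_mat_Cons[OF _ Cons.hyps(2)] det_four_block_mat_upper_right_zero[of _ p _ "sum_list ns"]
        del: diag_block_mat.simps(2))
qed simp

lemma upper_triangular_diag_block_mat: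
  assumes "list_all2 (\<lambda>B p. B \<in> carrier_mat p p) Bs ns" "\<forall>B \<in> set Bs. upper_triangular B"
  shows "upper_triangular (diag_block_mat Bs)"
  using assms
proof (induction rule: list_all2_induct)
  case (Cons B Bs p ns)
  then show ?case
    using diag_block_mat_carrier[OF Cons.hyps(2)]
    by (simp add: diag_block_mat_Cons[OF _ Cons.hyps(2)] upper_triangular_four_block
        del: diag_block_mat.simps(2))
qed (simp add: upper_triangular_def)

lemma diagonal_diag_block_mat:
  assumes "list_all2 (\<lambda>B p. B \<in> carrier_mat p p) Bs ns" "\<forall>B \<in> set Bs. diagonal_mat B"
  shows "diagonal_mat (diag_block_mat Bs)"
  using assms
proof (induction rule: list_all2_induct)
  case (Cons B Bs p ns)
  then show ?case
    using diag_block_mat_carrier[OF Cons.hyps(2)]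
    by (auto simp: diag_block_mat_Cons[OF _ Cons.hyps(2)] diagonal_mat_def
        simp del: diag_block_mat.simps(2))
qed (simp add: diagonal_mat_def)

lemma mat_diag_add:
  "mat_diag (p + q) f = four_block_mat (mat_diag p f) (0\<^sub>m p q) (0\<^sub>m q p) (mat_diag q (\<lambda>i. f (p + i)))"
  by (rule eq_matI) (auto simp: mat_diag_def)

text \<open>Cuts a diagonal matrix along the block sizes, as feasibility of the diagonal
  preconditioner demands. The predicate \<open>P\<close> hands a property of the entries, there
  positivity, down to the blocks.\<close>

lemma mat_diag_eq_diag_block_mat:
  assumes "\<And>i. i < sum_list ns \<Longrightarrow> P (f i)"
  shows "\<exists>Bs. mat_diag (sum_list ns) f = diag_block_mat Bs \<and>
    list_all2 (\<lambda>B p. \<exists>g. B = mat_diag p g \<and> (\<forall>i<p. P (g i))) Bs ns"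
  using assms
proof (induction ns arbitrary: f)
  case Nil
  show ?case by (auto simp: mat_diag_def intro!: exI[of _ "[]"] eq_matI)
next
  case (Cons p ns)
  obtain Bs where Bs: "mat_diag (sum_list ns) (\<lambda>i. f (p + i)) = diag_block_mat Bs"
    "list_all2 (\<lambda>B p. \<exists>g. B = mat_diag p g \<and> (\<forall>i<p. P (g i))) Bs ns"
    using Cons.IH[of "\<lambda>i. f (p + i)"] Cons.prems by auto
  have "list_all2 (\<lambda>B p. B \<in> carrier_mat p p) Bs ns"
    using Bs(2) by (rule list_all2_mono) auto
  then have "mat_diag (sum_list (p # ns)) f = diag_block_mat (mat_diag p f # Bs)"
    by (simp add: mat_diag_add Bs(1) diag_block_mat_Cons[of _ p] del: diag_block_mat.simps(2))
  moreover have "list_all2 (\<lambda>B p. \<exists>g. B = mat_diag p g \<and> (\<forall>i<p. P (g i))) (mat_diag p f # Bs) (p # ns)"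
    using Bs(2) Cons.prems by auto
  ultimately show ?case by blast
qed

section \<open>The feasible set in terms of determinants\<close>

lemma invertible_mat_iff_det_nonzero:
  fixes B :: "'a::field mat"
  assumes B: "B \<in> carrier_mat n n"
  shows "invertible_mat B \<longleftrightarrow> det B \<noteq> 0"
proof
  assume "invertible_mat B"
  then obtain C where C: "B * C = 1\<^sub>m n" "C * B = 1\<^sub>m (dim_row C)"
    using B by (auto simp: invertible_mat_def inverts_mat_def)
  \<comment> \<open>The definition of invertibility leaves the shape of the inverse open; it is read
    off from the dimensions in the two identities.\<close>
  have "dim_col C = n" using arg_cong[OF C(1), of dim_col] by simp
  moreover have "dim_row C = n" using arg_cong[OF C(2), of dim_col] B by simp
  ultimately have "C \<in> carrier_mat n n" by auto
  then show "det B \<noteq> 0" using det_mult[OF B, of C] C(1) by auto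
next
  assume "det B \<noteq> 0"
  then show "invertible_mat B"
    using det_non_zero_imp_unit[OF B, of "()"] B
    by (auto simp: Units_def ring_mat_def invertible_mat_def inverts_mat_def)
qed

text \<open>The form with \<open>list_all2\<close> suits the inductions over blocks, and nonzero
  determinants multiply to that of the whole matrix.\<close>

lemma blkdiag_feasible_iff:
  "blkdiag_feasible P ns B \<longleftrightarrow>
    (\<exists>Bs. list_all2 (\<lambda>B p. B \<in> carrier_mat p p) Bs ns \<and> (\<forall>B \<in> set Bs. det B \<noteq> 0 \<and> P B) \<and>
      B = diag_block_mat Bs)"
proof -
  have "(length Bs = length ns \<and> (\<forall>i<length ns. Bs ! i \<in> carrier_mat (ns ! i) (ns ! i) \<and>
        invertible_mat (Bs ! i) \<and> P (Bs ! i))) \<longleftrightarrow>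
      (list_all2 (\<lambda>B p. B \<in> carrier_mat p p) Bs ns \<and> (\<forall>B \<in> set Bs. det B \<noteq> 0 \<and> P B))" for Bs
    unfolding list_all2_conv_all_nth all_set_conv_all_nth
    using invertible_mat_iff_det_nonzero by metis
  then show ?thesis by (simp only: blkdiag_feasible_def flip: conj_assoc)
qed

section \<open>Diagonal entries, trace bounds and positivity\<close>

text \<open>Scaling acts column by column, and a diagonal entry of the Gram matrix is the squared
  length of a column. This yields the weights of the diagonal case.\<close>

lemma frob_sq_mult_mat_diag:
  assumes A: "A \<in> carrier_mat m n"
  shows "frob_sq (A * mat_diag n f) = (\<Sum>j<n. (transpose_mat A * A) $$ (j, j) * (f j)\<^sup>2)"
proof -
  have "frob_sq (A * mat_diag n f) = (\<Sum>j<n. \<Sum>i<m. (A $$ (i, j))\<^sup>2 * (f j)\<^sup>2)"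
    unfolding mat_diag_mult_right[OF A] frob_sq_def
    by (simp add: power_mult_distrib) (rule sum.swap)
  also have "\<dots> = (\<Sum>j<n. (transpose_mat A * A) $$ (j, j) * (f j)\<^sup>2)"
    using A by (intro sum.cong) (auto simp: scalar_prod_def power2_eq_square atLeast0LessThan sum_distrib_right)
  finally show ?thesis .
qed

lemma sum_diag_le_frob_sq:
  assumes "M \<in> carrier_mat n n"
  shows "(\<Sum>j<n. (M $$ (j, j))\<^sup>2) \<le> frob_sq M"
proof -
  have "(M $$ (i, i))\<^sup>2 \<le> (\<Sum>j<n. (M $$ (i, j))\<^sup>2)" if "i < n" for i
    using that by (intro member_le_sum) auto
  then show ?thesis using assms by (auto simp: frob_sq_def intro: sum_mono)
qed

lemma upper_triangular_mult_diag:
  fixes R B :: "'a::semiring_0 mat"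
  assumes "R \<in> carrier_mat n n" "B \<in> carrier_mat n n" "upper_triangular R" "upper_triangular B" "j < n"
  shows "(R * B) $$ (j, j) = R $$ (j, j) * B $$ (j, j)"
proof -
  have "(R * B) $$ (j, j) = (\<Sum>k<n. R $$ (j, k) * B $$ (k, j))"
    using assms by (simp add: scalar_prod_def atLeast0LessThan)
  also have "\<dots> = (\<Sum>k\<in>{j}. R $$ (j, k) * B $$ (k, j))"
  proof (rule sum.mono_neutral_right)
    show "\<forall>k \<in> {..<n} - {j}. R $$ (j, k) * B $$ (k, j) = 0"
    proof
      fix k assume k: "k \<in> {..<n} - {j}"
      then consider "k < j" | "j < k" by force
      then show "R $$ (j, k) * B $$ (k, j) = 0"
        using k assms by cases (auto simp: upper_triangular_def)
    qed
  qed (use assms in auto)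
  finally show ?thesis by simp
qed

text \<open>By a thin QR decomposition the Gram matrix of \<open>A\<close> is that of the square
  matrix \<open>R\<close>, so its determinant is a nonzero square.\<close>

lemma det_gram_pos:
  fixes A :: "real mat"
  assumes A: "A \<in> carrier_mat m n" and inj: "inj_cols A"
  shows "det (transpose_mat A * A) > 0"
proof -
  obtain Q R where "thin_QR A Q R" using thin_QR_exists[OF assms] by blast
  then have Q: "Q \<in> carrier_mat m n" and R: "R \<in> carrier_mat n n" and iso: "transpose_mat Q * Q = 1\<^sub>m n"
    and A_eq: "A = Q * R"
    using A by (auto simp: thin_QR_def)
  have "inj_cols R" using inj_cols_multD[OF _ Q R] inj A_eq by simp
  then have "det R \<noteq> 0" using R by (rule inj_cols_imp_det_nonzero)
  moreover have "transpose_mat A * A = transpose_mat R * ((transpose_mat Q * Q) * R)"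
    using Q R unfolding A_eq by (simp add: transpose_mult[OF Q R] assoc_mult_mat[of _ n m _ n _ n]
        assoc_mult_mat[of _ n n _ m _ n])
  then have "det (transpose_mat A * A) = (det R)\<^sup>2"
    using R iso by (simp add: det_mult[of _ n] det_transpose[of _ n] power2_eq_square)
  ultimately show ?thesis by simp
qed

text \<open>The entry is the squared length of column \<open>j\<close>; a zero column would put a
  unit vector into the kernel.\<close>

lemma gram_diag_pos:
  fixes A :: "real mat"
  assumes A: "A \<in> carrier_mat m n" and inj: "inj_cols A" and j: "j < n"
  shows "(transpose_mat A * A) $$ (j, j) > 0"
proof -
  have eq: "(transpose_mat A * A) $$ (j, j) = (\<Sum>i<m. (A $$ (i, j))\<^sup>2)"
    using A j by (simp add: scalar_prod_def power2_eq_square atLeast0LessThan)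
  have "\<exists>i<m. A $$ (i, j) \<noteq> 0"
  proof (rule ccontr)
    assume "\<not> ?thesis"
    then have "A *\<^sub>v unit_vec n j = 0\<^sub>v m" using A j by (intro eq_vecI) auto
    then have "unit_vec n j = (0\<^sub>v n :: real vec)"
      using inj_cols_mat_mult_vec[OF inj A] by simp
    from arg_cong[OF this, of "\<lambda>v. v $ j"] show False using j by simp
  qed
  then obtain i where "i < m" "A $$ (i, j) \<noteq> 0" by blast
  then show ?thesis unfolding eq by (intro sum_pos2[of _ i]) auto
qed

lemma det_mat_diag: "det (mat_diag n f) = (\<Prod>i<n. f i)" for f :: "nat \<Rightarrow> 'a::comm_ring_1"
  by (subst det_upper_triangular[of _ n])
    (auto simp: prod_list_diag_prod upper_triangular_def mat_diag_def atLeast0LessThan)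

section \<open>Optimality of the two preconditioners\<close>

text \<open>The AM-GM bound is used with the squared column lengths \<open>g\<close> as weights. The
  candidate scales all columns to length 1, so each weighted square
  \<open>g j * (f j)\<^sup>2\<close> is 1, which gives both the trace and the determinant
  condition.\<close>

lemma is_arg_min_diagonal:
  fixes A :: "real mat"
  assumes A: "A \<in> carrier_mat m n" and inj: "inj_cols A" and n: "0 < n" and ns: "sum_list ns = n"
  shows "is_arg_min (\<lambda>B. omega (transpose_mat (A * B) * (A * B))) (blkdiag_feasible diagonal_mat ns)
    (diag_powr (Diag (diag_mat (transpose_mat A * A))) (- 1 / 2))"
proof -
  define g where "g j = (transpose_mat A * A) $$ (j, j)" for j
  define f where "f j = g j powr (- 1 / 2)" for j
  have g: "g j > 0" if "j < n" for j using gram_diag_pos[OF A inj that] by (simp add: g_def)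
  have f: "f j > 0" "g j * (f j)\<^sup>2 = 1" if "j < n" for j
  proof -
    show "f j > 0" using g[OF that] by (simp add: f_def)
    have "(f j)\<^sup>2 = g j powr (- 1 / 2 + - 1 / 2)"
      unfolding f_def power2_eq_square powr_add ..
    then show "g j * (f j)\<^sup>2 = 1" using g[OF that] by (simp add: powr_minus)
  qed
  have B\<^sub>0: "diag_powr (Diag (diag_mat (transpose_mat A * A))) (- 1 / 2) = mat_diag n f"
    using A unfolding diag_powr_Diag by (intro eq_matI) (auto simp: mat_diag_def diag_mat_def f_def g_def)
  have feas: "blkdiag_feasible diagonal_mat ns (mat_diag n f)"
  proof -
    obtain Bs where Bs: "mat_diag n f = diag_block_mat Bs"
      "list_all2 (\<lambda>B p. \<exists>g. B = mat_diag p g \<and> (\<forall>i<p. g i > (0 :: real))) Bs ns"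
      using mat_diag_eq_diag_block_mat[of ns "\<lambda>x. x > 0" f] f ns by auto
    have "list_all2 (\<lambda>B p. B \<in> carrier_mat p p) Bs ns"
      using Bs(2) by (rule list_all2_mono) auto
    moreover have "\<forall>B \<in> set Bs. det B \<noteq> 0 \<and> diagonal_mat B"
    proof
      fix B assume "B \<in> set Bs"
      then obtain p h where B: "B = mat_diag p h" "\<forall>i<p. h i > 0"
        using Bs(2) by (force simp: list_all2_conv_all_nth in_set_conv_nth)
      have "det B > 0" unfolding B(1) det_mat_diag using B(2) by (intro prod_pos) auto
      moreover have "diagonal_mat B" by (simp add: B(1) diagonal_mat_def mat_diag_def)
      ultimately show "det B \<noteq> 0 \<and> diagonal_mat B" by simp
    qed
    ultimately show ?thesis unfolding blkdiag_feasible_iff Bs(1) by blast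
  qed
  have "omega (transpose_mat (A * mat_diag n f) * (A * mat_diag n f)) \<le> omega (transpose_mat (A * B) * (A * B))"
    if B_feas: "blkdiag_feasible diagonal_mat ns B" for B
  proof -
    obtain Bs where Bs: "list_all2 (\<lambda>B p. B \<in> carrier_mat p p) Bs ns" "\<forall>B \<in> set Bs. det B \<noteq> 0 \<and> diagonal_mat B"
      and B_eq: "B = diag_block_mat Bs"
      using B_feas unfolding blkdiag_feasible_iff by blast
    have B: "B \<in> carrier_mat n n" using diag_block_mat_carrier[OF Bs(1)] B_eq ns by simp
    have "diagonal_mat B" unfolding B_eq using Bs by (intro diagonal_diag_block_mat) auto
    then have B_diag: "B = mat_diag n (\<lambda>j. B $$ (j, j))"
      using B by (auto intro!: eq_matI simp: diagonal_mat_def mat_diag_def)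
    show ?thesis
    proof (rule omega_gram_le[OF A n det_gram_pos[OF A inj] B, where c = g])
      show "upper_triangular B" using \<open>diagonal_mat B\<close> B by (auto simp: diagonal_mat_def upper_triangular_def)
      show "det B \<noteq> 0" unfolding B_eq det_diag_block_mat[OF Bs(1)] using Bs(2) by (auto simp: prod_list_zero_iff)
      \<comment> \<open>For diagonal \<open>B\<close> this bound is an equality. \<open>B\<close> is
        rewritten to explicit diagonal form only inside the product with \<open>A\<close>.\<close>
      show "(\<Sum>j<n. g j * (B $$ (j, j))\<^sup>2) \<le> mat_trace (transpose_mat (A * B) * (A * B))"
        unfolding mat_trace_gram
        by (subst (2) B_diag) (simp add: frob_sq_mult_mat_diag[OF A] g_def)
      show "mat_trace (transpose_mat (A * mat_diag n f) * (A * mat_diag n f)) = real n"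
        unfolding mat_trace_gram frob_sq_mult_mat_diag[OF A] using f(2) by (simp add: g_def)
      have "(det (mat_diag n f))\<^sup>2 * prod g {..<n} = (\<Prod>j<n. g j * (f j)\<^sup>2)"
        by (simp add: det_mat_diag prod.distrib prod_power_distrib mult.commute)
      then show "(det (mat_diag n f))\<^sup>2 * prod g {..<n} = 1" using f(2) by simp
    qed (use g in auto)
  qed
  then show ?thesis
    unfolding B\<^sub>0 is_arg_min_def using feas by (auto simp: not_less)
qed

text \<open>As far as the trace is concerned, \<open>A\<close> may be replaced by the square upper
  triangular \<open>R\<close>. The candidate \<open>S\<close> is the inverse of \<open>R\<close>, so
  the product has norm and determinant of an identity matrix.\<close>

lemma is_arg_min_upper_triangular:
  assumes As: "list_all2 (\<lambda>A p. A \<in> carrier_mat m p) As ns" and inj: "inj_cols (block_row m As)"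
    and n: "0 < sum_list ns"
    and len: "length Qs = length ns" "length Rs = length ns"
    and QR: "\<forall>i<length ns. thin_QR (As ! i) (Qs ! i) (Rs ! i)"
  shows "is_arg_min (\<lambda>B. omega (transpose_mat (block_row m As * B) * (block_row m As * B)))
    (blkdiag_feasible upper_triangular ns) (diag_block_mat (map (\<lambda>R. the (mat_inverse R)) Rs))"
proof -
  define A where "A = block_row m As"
  define R where "R = diag_block_mat Rs"
  define Ss where "Ss = map (\<lambda>R. the (mat_inverse R)) Rs"
  let ?n = "sum_list ns"
  have A: "A \<in> carrier_mat m ?n" using block_row_carrier[OF As] by (simp add: A_def)
  have block: "As ! i \<in> carrier_mat m (ns ! i)" "Qs ! i \<in> carrier_mat m (ns ! i)"
      "Rs ! i \<in> carrier_mat (ns ! i) (ns ! i)" "transpose_mat (Qs ! i) * Qs ! i = 1\<^sub>m (ns ! i)"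
      "upper_triangular (Rs ! i)" "As ! i = Qs ! i * Rs ! i"
    if i: "i < length ns" for i
  proof -
    show Ai: "As ! i \<in> carrier_mat m (ns ! i)" using As i by (simp add: list_all2_conv_all_nth)
    note QR[rule_format, OF i, unfolded thin_QR_def carrier_matD[OF Ai]]
    then show "Qs ! i \<in> carrier_mat m (ns ! i)" "Rs ! i \<in> carrier_mat (ns ! i) (ns ! i)"
      "transpose_mat (Qs ! i) * Qs ! i = 1\<^sub>m (ns ! i)" "upper_triangular (Rs ! i)" "As ! i = Qs ! i * Rs ! i"
      by blast+
  qed
  have Rs: "list_all2 (\<lambda>B p. B \<in> carrier_mat p p) Rs ns"
    using len block(3) by (simp add: list_all2_conv_all_nth)
  have R: "R \<in> carrier_mat ?n ?n" using diag_block_mat_carrier[OF Rs] by (simp add: R_def)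
  have R_ut: "upper_triangular R"
    unfolding R_def using block(5) len by (intro upper_triangular_diag_block_mat[OF Rs]) (auto simp: in_set_conv_nth)
  have inverse: "Ss ! i \<in> carrier_mat (ns ! i) (ns ! i) \<and> Rs ! i * Ss ! i = 1\<^sub>m (ns ! i) \<and>
      det (Ss ! i) \<noteq> 0 \<and> upper_triangular (Ss ! i)"
    if i: "i < length ns" for i
  proof -
    note R = block(3)[OF i]
    have "As ! i \<in> set As" using As i by (auto dest: list_all2_lengthD)
    then have "inj_cols (As ! i)" by (rule inj_cols_block_row[OF As inj])
    then have "inj_cols (Rs ! i)" using inj_cols_multD[OF _ block(2)[OF i] R] block(6)[OF i] by simp
    then have det: "det (Rs ! i) \<noteq> 0" using R by (rule inj_cols_imp_det_nonzero)
    then obtain S where "mat_inverse (Rs ! i) = Some S"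
      using mat_inverse(1)[OF R, of "()"] det_non_zero_imp_unit[OF R, of "()"] by fastforce
    note S = this mat_inverse(2)[OF R this]
    have "det (Rs ! i) * det S = 1" using S det_mult[OF R, of S] by simp
    \<comment> \<open>\<open>S * Rs ! i\<close> is the identity, so the shape passes to the left
      factor \<open>S\<close>.\<close>
    moreover have "upper_triangular S"
      using upper_triangular_left_factor[OF _ R block(5)[OF i] det] S by simp
    ultimately show ?thesis using S i len by (auto simp: Ss_def)
  qed
  have Ss: "list_all2 (\<lambda>B p. B \<in> carrier_mat p p) Ss ns"
    using len inverse by (simp add: list_all2_conv_all_nth Ss_def)
  have Ss_set: "\<forall>S \<in> set Ss. det S \<noteq> 0 \<and> upper_triangular S"
    using inverse len by (auto simp: in_set_conv_nth Ss_def)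
  define S where "S = diag_block_mat Ss"
  have S: "S \<in> carrier_mat ?n ?n" using diag_block_mat_carrier[OF Ss] by (simp add: S_def)
  have RS: "R * S = 1\<^sub>m ?n"
  proof -
    have "map2 (*) Rs Ss = map (\<lambda>R. 1\<^sub>m (dim_row R)) Rs"
    proof (rule nth_equalityI)
      fix i assume "i < length (map2 (*) Rs Ss)"
      then have i: "i < length ns" "i < length Rs" "i < length Ss" using len by (auto simp: Ss_def)
      then show "map2 (*) Rs Ss ! i = map (\<lambda>R. 1\<^sub>m (dim_row R)) Rs ! i"
        using inverse[OF i(1)] carrier_matD(1)[OF block(3)[OF i(1)]] by simp
    qed (simp add: Ss_def)
    moreover have "map dim_row Rs = ns"
    proof (rule nth_equalityI)
      fix i assume "i < length (map dim_row Rs)"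
      then have i: "i < length ns" "i < length Rs" using len by auto
      then show "map dim_row Rs ! i = ns ! i" using carrier_matD(1)[OF block(3)[OF i(1)]] by simp
    qed (simp add: len)
    ultimately show ?thesis
      using diag_block_mat_mult[OF Rs Ss] by (simp add: R_def S_def)
  qed
  then have det_RS: "det R * det S = 1" using det_mult[OF R S] by simp
  have det_R: "det R = (\<Prod>j<?n. R $$ (j, j))"
    using R det_upper_triangular[OF R_ut R] by (simp add: prod_list_diag_prod atLeast0LessThan)
  have "(\<Prod>j<?n. R $$ (j, j)) \<noteq> 0" using det_RS unfolding det_R by (metis mult_zero_left zero_neq_one)
  then have R_diag: "R $$ (j, j) \<noteq> 0" if "j < ?n" for j using that by simp
  \<comment> \<open>Each \<open>Qs ! i\<close> drops out of the norm of its block, and the blocks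
    \<open>Rs ! i * Bs ! i\<close> reassemble to the product with \<open>R\<close>.\<close>
  have trace: "mat_trace (transpose_mat (A * diag_block_mat Bs) * (A * diag_block_mat Bs)) =
      frob_sq (R * diag_block_mat Bs)"
    if Bs: "list_all2 (\<lambda>B p. B \<in> carrier_mat p p) Bs ns" for Bs
  proof -
    have "map2 (\<lambda>A B. frob_sq (A * B)) As Bs = map frob_sq (map2 (*) Rs Bs)"
    proof (intro nth_equalityI)
      show "length (map2 (\<lambda>A B. frob_sq (A * B)) As Bs) = length (map frob_sq (map2 (*) Rs Bs))"
        using As len by (simp add: list_all2_lengthD)
      fix i assume "i < length (map2 (\<lambda>A B. frob_sq (A * B)) As Bs)"
      then have i: "i < length ns" and len': "length As = length ns" "length Bs = length ns"
        using As Bs by (auto dest: list_all2_lengthD)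
      have B: "Bs ! i \<in> carrier_mat (ns ! i) (ns ! i)" using Bs i by (simp add: list_all2_conv_all_nth)
      have "As ! i * Bs ! i = Qs ! i * (Rs ! i * Bs ! i)"
        using assoc_mult_mat[OF block(2,3)[OF i] B] block(6)[OF i] by simp
      then have "frob_sq (As ! i * Bs ! i) = frob_sq (Rs ! i * Bs ! i)"
        using frob_sq_isometry[OF block(2,4)[OF i] mult_carrier_mat[OF block(3)[OF i] B]] by simp
      then show "map2 (\<lambda>A B. frob_sq (A * B)) As Bs ! i = map frob_sq (map2 (*) Rs Bs) ! i"
        using i len len' by simp
    qed
    then show ?thesis
      unfolding mat_trace_gram A_def R_def frob_sq_block_row_mult[OF As Bs]
      using diag_block_mat_mult[OF Rs Bs]
        frob_sq_diag_block_mat[OF conjunct2[OF diag_block_mat_mult[OF Rs Bs]]] by simp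
  qed
  have feas: "blkdiag_feasible upper_triangular ns S"
    unfolding blkdiag_feasible_iff S_def using Ss Ss_set by blast
  have "omega (transpose_mat (A * S) * (A * S)) \<le> omega (transpose_mat (A * B) * (A * B))"
    if B_feas: "blkdiag_feasible upper_triangular ns B" for B
  proof -
    obtain Bs where Bs: "list_all2 (\<lambda>B p. B \<in> carrier_mat p p) Bs ns" "\<forall>B \<in> set Bs. det B \<noteq> 0 \<and> upper_triangular B"
      and B_eq: "B = diag_block_mat Bs"
      using B_feas unfolding blkdiag_feasible_iff by blast
    have B: "B \<in> carrier_mat ?n ?n" using diag_block_mat_carrier[OF Bs(1)] B_eq by simp
    have B_ut: "upper_triangular B" unfolding B_eq using Bs by (intro upper_triangular_diag_block_mat) auto
    show ?thesis
    proof (rule omega_gram_le[OF A n det_gram_pos[OF A] B B_ut, where c = "\<lambda>j. (R $$ (j, j))\<^sup>2"])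
      show "det B \<noteq> 0" unfolding B_eq det_diag_block_mat[OF Bs(1)] using Bs(2) by (auto simp: prod_list_zero_iff)
      \<comment> \<open>Diagonal entries of upper triangular matrices multiply, so the weighted sum
        is the diagonal part of the norm of \<open>R * B\<close>; the off-diagonal squares are
        dropped.\<close>
      have "(\<Sum>j<?n. (R $$ (j, j))\<^sup>2 * (B $$ (j, j))\<^sup>2) = (\<Sum>j<?n. ((R * B) $$ (j, j))\<^sup>2)"
        by (intro sum.cong) (auto simp: upper_triangular_mult_diag[OF R B R_ut B_ut] power_mult_distrib
            simp del: index_mult_mat)
      also have "\<dots> \<le> frob_sq (R * B)" using R B by (intro sum_diag_le_frob_sq) auto
      finally show "(\<Sum>j<?n. (R $$ (j, j))\<^sup>2 * (B $$ (j, j))\<^sup>2) \<le> mat_trace (transpose_mat (A * B) * (A * B))"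
        unfolding B_eq trace[OF Bs(1)] .
      show "mat_trace (transpose_mat (A * S) * (A * S)) = real ?n"
        using trace[OF Ss] RS by (simp add: S_def)
      have "(det S)\<^sup>2 * (\<Prod>j<?n. (R $$ (j, j))\<^sup>2) = (det R * det S)\<^sup>2"
        by (simp add: det_R prod_power_distrib power_mult_distrib)
      then show "(det S)\<^sup>2 * (\<Prod>j<?n. (R $$ (j, j))\<^sup>2) = 1" using det_RS by simp
    qed (use inj R_diag S in \<open>auto simp: A_def\<close>)
  qed
  then show ?thesis
    unfolding is_arg_min_def A_def[symmetric] Ss_def[symmetric] S_def[symmetric]
    using feas by (auto simp: not_less)
qed

text \<open>Since the factors are determined only up to signs, the last conjunct quantifies over
  every choice of QR decompositions. Existence keeps this from being vacuous, and the sign statement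
  describes the freedom left.\<close>

theorem corollary3p11:
  fixes m n k :: nat and ns :: "nat list" and As :: "real mat list" and A :: "real mat"
  assumes "length ns = k" and "length As = k"
    and "\<forall>i<k. As ! i \<in> carrier_mat m (ns ! i)"
    and "sum_list ns = n" and "0 < n" and "n \<le> m"
    and "A = block_row m As"
    and "vec_space.rank m A = n"
  shows
    "is_arg_min (\<lambda>B. omega (transpose_mat (A * B) * (A * B))) (blkdiag_feasible diagonal_mat ns)
        (diag_powr (Diag (diag_mat (transpose_mat A * A))) (- 1 / 2))
     \<and>
     (\<forall>i<k. \<exists>Q R. thin_QR (As ! i) Q R) \<and>
     (\<forall>i<k. \<forall>Q R Q' R'. thin_QR (As ! i) Q R \<longrightarrow> thin_QR (As ! i) Q' R' \<longrightarrow>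
        (\<exists>s. (\<forall>j<ns ! i. s j \<in> {1, - 1}) \<and>
             R' = mat_diag (ns ! i) s * R \<and> Q' = Q * mat_diag (ns ! i) s)) \<and>
     (\<forall>Qs Rs. length Qs = k \<longrightarrow> length Rs = k \<longrightarrow>
        (\<forall>i<k. thin_QR (As ! i) (Qs ! i) (Rs ! i)) \<longrightarrow>
        is_arg_min (\<lambda>B. omega (transpose_mat (A * B) * (A * B))) (blkdiag_feasible upper_triangular ns)
          (diag_block_mat (map (\<lambda>R. the (mat_inverse R)) Rs)))"
proof -
  have As: "list_all2 (\<lambda>A p. A \<in> carrier_mat m p) As ns"
    using assms(1-3) by (simp add: list_all2_conv_all_nth)
  have A: "A \<in> carrier_mat m n" using block_row_carrier[OF As] assms(4,7) by simp
  have inj: "inj_cols A" using vec_space.full_rank_inj_cols[OF A assms(8)] .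
  have block: "As ! i \<in> carrier_mat m (ns ! i)" "inj_cols (As ! i)" if "i < k" for i
    using assms(2,3) that inj_cols_block_row[OF As, of "As ! i"] inj assms(7) by auto
  show ?thesis
  proof (intro conjI allI impI)
    show "is_arg_min (\<lambda>B. omega (transpose_mat (A * B) * (A * B))) (blkdiag_feasible diagonal_mat ns)
        (diag_powr (Diag (diag_mat (transpose_mat A * A))) (- 1 / 2))"
      by (rule is_arg_min_diagonal[OF A inj assms(5,4)])
  next
    fix i assume "i < k"
    then show "\<exists>Q R. thin_QR (As ! i) Q R" using thin_QR_exists[OF block] by blast
  next
    fix i Q R Q' R' assume "i < k" "thin_QR (As ! i) Q R" "thin_QR (As ! i) Q' R'"
    then show "\<exists>s. (\<forall>j<ns ! i. s j \<in> {1, - 1}) \<and>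
        R' = mat_diag (ns ! i) s * R \<and> Q' = Q * mat_diag (ns ! i) s"
      using thin_QR_unique[OF block] by blast
  next
    fix Qs Rs
    assume "length Qs = k" "length Rs = k" "\<forall>i<k. thin_QR (As ! i) (Qs ! i) (Rs ! i)"
    then show "is_arg_min (\<lambda>B. omega (transpose_mat (A * B) * (A * B))) (blkdiag_feasible upper_triangular ns)
        (diag_block_mat (map (\<lambda>R. the (mat_inverse R)) Rs))"
      using is_arg_min_upper_triangular[OF As inj[unfolded assms(7)], of Qs Rs] assms(1,4,5,7) by simp
  qed
qed

end
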